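(* Let $\Omega\subset\mathbb{R}^n$ be a bounded Lipschitz domain, $0<a<1$, and $v\in H^a(\Omega)$. If $v=(-\Delta)^a_\Omega v=0$ on a non-empty open subset $\mathcal{O}\Subset\Omega$ (i.e. compactly contained in $\Omega$), then $v=0$ in $\Omega$.
   Context: All functions are real valued. $H^a(\Omega)$ is the space of restrictions to $\Omega$ of elements of the $L^2$-based Sobolev space $H^a(\mathbb{R}^n)$. The regional fractional Laplacian is $(-\Delta)^a_\Omega u(x)=C_{n,a}\,\mathrm{p.v.}\int_\Omega\frac{u(x)-u(y)}{|x-y|^{n+2a}}dy$ for smooth $u$ on $\overline\Omega$ (with a constant $C_{n,a}>0$), extended to $u\in H^a(\Omega)$ weakly by $$\langle(-\Delta)^a_\Omega u,\psi\rangle=\frac{C_{n,a}}{2}\int_\Omega\int_\Omega\frac{(u(x)-u(y))(\psi(x)-\psi(y))}{|x-y|^{n+2a}}dy\,dx.$$ That $(-\Delta)^a_\Omega v=0$ on $\mathcal{O}$ means this pairing vanishes for all $\psi\in C_c^\infty(\mathcal{O})$. *)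

theory Defs
  imports "HOL-Analysis.Analysis"
begin

text \<open>
  Functions on an open set are represented by total functions of which only the values on that
  set matter, and equality of Sobolev functions is equality almost everywhere. All integrals are
  with respect to the completed measure \<^const>\<open>lebesgue\<close>, so that changing a function
  on a null set does not affect measurability.
\<close>

section \<open>Bounded Lipschitz domains\<close>

text \<open>
  Near each boundary point, in a rotated orthonormal coordinate system whose last axis is the
  unit vector \<open>e\<close>, the set is the strict epigraph of a Lipschitz function \<open>\<gamma>\<close>
  on the hyperplane orthogonal to \<open>e\<close>; the vector \<open>x - (x \<bullet> e) *\<^sub>R e\<close> is the
  orthogonal projection of \<open>x\<close> to that hyperplane.
\<close>

definition lipschitz_boundary :: "'a::euclidean_space set \<Rightarrow> bool" where
  "lipschitz_boundary \<Omega> \<longleftrightarrow>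
     (\<forall>p \<in> frontier \<Omega>. \<exists>r>0. \<exists>e \<gamma> L. norm e = 1 \<and> L-lipschitz_on {z. z \<bullet> e = 0} \<gamma> \<and>
        \<Omega> \<inter> ball p r = {x \<in> ball p r. x \<bullet> e > \<gamma> (x - (x \<bullet> e) *\<^sub>R e)})"

definition bounded_lipschitz_domain :: "'a::euclidean_space set \<Rightarrow> bool" where
  "bounded_lipschitz_domain \<Omega> \<longleftrightarrow>
     open \<Omega> \<and> connected \<Omega> \<and> \<Omega> \<noteq> {} \<and> bounded \<Omega> \<and> lipschitz_boundary \<Omega>"

section \<open>Test functions\<close>

primrec Ck :: "nat \<Rightarrow> ('a::euclidean_space \<Rightarrow> real) \<Rightarrow> bool" where
  "Ck 0 f \<longleftrightarrow> continuous_on UNIV f"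
| "Ck (Suc k) f \<longleftrightarrow>
     f differentiable_on UNIV \<and> (\<forall>h. Ck k (\<lambda>x. frechet_derivative f (at x) h))"

definition smooth :: "('a::euclidean_space \<Rightarrow> real) \<Rightarrow> bool" where
  "smooth f \<longleftrightarrow> (\<forall>k. Ck k f)"

text \<open>\<open>C\<^sub>c\<^sup>\<infinity>(U)\<close>, its elements being extended by zero to the whole space.\<close>

definition test_functions :: "'a::euclidean_space set \<Rightarrow> ('a \<Rightarrow> real) set" where
  "test_functions U =
     {\<psi>. smooth \<psi> \<and> compact (closure {x. \<psi> x \<noteq> 0}) \<and> closure {x. \<psi> x \<noteq> 0} \<subseteq> U}"

section \<open>Sobolev spaces\<close>

definition square_integrable :: "('a::euclidean_space \<Rightarrow> real) \<Rightarrow> bool" where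
  "square_integrable u \<longleftrightarrow>
     u \<in> borel_measurable lebesgue \<and> integrable lebesgue (\<lambda>x. (u x)\<^sup>2)"

text \<open>
  The Fourier transform on \<open>L\<^sup>2\<close> in Plancherel's sense: \<open>g\<close> is the \<open>L\<^sup>2\<close>-limit, as
  \<open>R \<rightarrow> \<infinity>\<close>, of \<open>\<xi> \<mapsto> \<integral>\<^bsub>\<bar>x\<bar> < R\<^esub> exp (- \<i> x \<cdot> \<xi>) u(x) dx\<close>.
\<close>

definition has_fourier_transform ::
    "('a::euclidean_space \<Rightarrow> real) \<Rightarrow> ('a \<Rightarrow> complex) \<Rightarrow> bool" where
  "has_fourier_transform u g \<longleftrightarrow>
     g \<in> borel_measurable lebesgue \<and>
     ((\<lambda>R::real. \<integral>\<^sup>+ \<xi>. ennreal ((cmod (g \<xi> -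
          (LINT x:ball 0 R|lebesgue. cis (- (x \<bullet> \<xi>)) * complex_of_real (u x))))\<^sup>2) \<partial>lebesgue)
        \<longlongrightarrow> 0) at_top"

text \<open>
  \<open>H\<^sup>a(\<real>\<^sup>n)\<close> for \<open>a \<ge> 0\<close>: those \<open>u \<in> L\<^sup>2\<close> whose Fourier transform \<open>g\<close>
  satisfies \<open>(1 + \<bar>\<xi>\<bar>\<^sup>2)\<^bsup>a/2\<^esup> g(\<xi>) \<in> L\<^sup>2\<close>.
\<close>

definition sobolev :: "real \<Rightarrow> ('a::euclidean_space \<Rightarrow> real) set" where
  "sobolev a = {u. square_integrable u \<and>
     (\<exists>g. has_fourier_transform u g \<and>
        integrable lebesgue (\<lambda>\<xi>. (1 + (norm \<xi>)\<^sup>2) powr a * (cmod (g \<xi>))\<^sup>2))}"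

definition sobolev_on :: "real \<Rightarrow> 'a::euclidean_space set \<Rightarrow> ('a \<Rightarrow> real) set" where
  "sobolev_on a \<Omega> = {v. \<exists>w \<in> sobolev a. AE x\<in>\<Omega> in lebesgue. v x = w x}"

section \<open>The regional fractional Laplacian\<close>

text \<open>
  The value \<open>\<langle>(-\<Delta>)\<^sup>a\<^sub>\<Omega> u, \<psi>\<rangle>\<close>; the parameter \<open>C\<close> is the normalising constant
  \<open>C\<^bsub>n,a\<^esub>\<close>. On the diagonal the integrand is \<open>0 / 0 = 0\<close>, which concerns a null set only.
\<close>

definition regional_pairing ::
    "real \<Rightarrow> real \<Rightarrow> 'a::euclidean_space set \<Rightarrow> ('a \<Rightarrow> real) \<Rightarrow> ('a \<Rightarrow> real) \<Rightarrow> real" where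
  "regional_pairing C a \<Omega> u \<psi> =
     C / 2 * (LINT x:\<Omega>|lebesgue. (LINT y:\<Omega>|lebesgue.
        (u x - u y) * (\<psi> x - \<psi> y) / norm (x - y) powr (real DIM('a) + 2 * a)))"

definition regional_laplacian_vanishes_on ::
    "real \<Rightarrow> real \<Rightarrow> 'a::euclidean_space set \<Rightarrow> ('a \<Rightarrow> real) \<Rightarrow> 'a set \<Rightarrow> bool" where
  "regional_laplacian_vanishes_on C a \<Omega> u U \<longleftrightarrow>
     (\<forall>\<psi> \<in> test_functions U. regional_pairing C a \<Omega> u \<psi> = 0)"

end

theory Submission
  imports Defs
begin

text \<open>
  Let \<open>w\<close> be \<open>v\<close> on \<open>\<Omega> - U\<close> and \<open>0\<close> elsewhere. It is integrable, has bounded support and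
  vanishes on \<open>U\<close>. For a test function \<open>\<psi>\<close> with support in \<open>U\<close> the product \<open>w \<psi>\<close> vanishes, so
  the regional pairing of \<open>v\<close> with \<open>\<psi>\<close> reduces, by Fubini's theorem, to
  \<open>- C \<integral> \<psi>(x) G(x) dx\<close> with \<open>G(x) = \<integral> w(y) \<bar>x - y\<bar>\<^bsup>-n-2a\<^esup> dy\<close>. On \<open>U\<close> the kernel is only
  evaluated away from its singularity, hence \<open>G\<close> is continuous there, and testing with bump
  functions gives \<open>G = 0\<close> on \<open>U\<close> (\<open>regional_vanishing_imp_riesz_0\<close>).

  It remains to see that a Riesz potential of \<open>w\<close> that vanishes on an open set where \<open>w\<close> itself
  vanishes forces \<open>w = 0\<close> (\<open>riesz_unique_continuation\<close>). Three observations do this without any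
  regularity theory.

  \<^item> The Laplacian of \<open>\<bar>z\<bar>\<^bsup>-s\<^esup>\<close> is \<open>s (s + 2 - n) \<bar>z\<bar>\<^bsup>-s-2\<^esup>\<close>. Starting from \<open>s = n + 2a > n - 2\<close> the
    factor never vanishes, so \<open>\<integral> w(y) \<bar>x - y\<bar>\<^bsup>-s-2k\<^esup> dy = 0\<close> for all \<open>k\<close> and all \<open>x \<in> U\<close>
    (\<open>riesz_raise_exponent\<close>).

  \<^item> For fixed \<open>x \<in> U\<close> the values of \<open>\<bar>x - y\<bar>\<^sup>-\<^sup>2\<close> with \<open>w(y) \<noteq> 0\<close> stay in a compact subset of
    \<open>(0, \<infinity>)\<close>. By Weierstrass' theorem powers may be replaced by any continuous function:
    \<open>\<integral> w(y) f(\<bar>x - y\<bar>\<^sup>2) dy = 0\<close> (\<open>radial_integral_eq_0\<close>). In other words, the integrals of \<open>w\<close>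
    over almost all spheres around \<open>x\<close> vanish.

  \<^item> Choose \<open>f\<close> so as to obtain Gaussians centred in a ball inside \<open>U\<close>. The product of two
    Gaussians is a multiple of a Gaussian whose centre is a convex combination of the two centres.
    Sums of Gaussians with centres in a ball therefore form an algebra, which contains the
    constants and separates points. By the Stone--Weierstrass theorem \<open>w\<close> is orthogonal to all
    continuous functions, and so \<open>w = 0\<close> almost everywhere.
\<close>

section \<open>Smooth bump functions\<close>

text \<open>
  The functions \<open>exp (-1/t) / t\<^sup>k\<close>, extended by zero, are flat at the origin, and their span over
  all \<open>k\<close> is closed under differentiation. Keeping the index \<open>k\<close> avoids any computation of
  higher derivatives.
\<close>

definition flat :: "nat \<Rightarrow> real \<Rightarrow> real" where
  "flat k t = (if t > 0 then exp (- (1 / t)) / t ^ k else 0)"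

lemma flat_tendsto_0: "(flat k \<longlongrightarrow> 0) (at 0)"
proof -
  have "((\<lambda>t. (1 / t) ^ k / exp (1 / t)) \<longlongrightarrow> (0::real)) (at_right 0)"
    by (rule filterlim_compose[OF tendsto_power_div_exp_0])
       (simp add: filterlim_inverse_at_top_right divide_inverse)
  moreover have "eventually (\<lambda>t. (1 / t) ^ k / exp (1 / t) = flat k t) (at_right (0::real))"
    using eventually_at_right_less[of "0::real"]
    by eventually_elim (simp add: flat_def exp_minus power_divide divide_simps)
  ultimately have R: "(flat k \<longlongrightarrow> 0) (at_right 0)"
    by (rule Lim_transform_eventually)
  have "eventually (\<lambda>t. 0 = flat k t) (at_left 0)"
    by (auto simp: flat_def eventually_at_filter)
  then have L: "(flat k \<longlongrightarrow> 0) (at_left 0)"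
    by (rule Lim_transform_eventually[OF tendsto_const])
  show ?thesis using L R by (simp add: filterlim_split_at)
qed

lemma flat_has_field_derivative:
  "(flat k has_field_derivative flat (k + 2) t - k * flat (k + 1) t) (at t)"
proof -
  consider "t > 0" | "t < 0" | "t = 0" by linarith
  then show ?thesis
  proof cases
    case 1
    have "((\<lambda>t. inverse t ^ k) has_field_derivative - (k * inverse t ^ (k + 1))) (at t)"
    proof (cases k)
      case (Suc m)
      then show ?thesis
        using DERIV_power_Suc[OF DERIV_inverse, of t m] 1
        by (simp add: algebra_simps power2_eq_square)
    qed (use 1 in simp)
    moreover have "((\<lambda>t. exp (- (1 / t))) has_field_derivative exp (- (1 / t)) * inverse t ^ 2) (at t)"
      using 1 by (auto intro!: derivative_eq_intros simp: field_simps power2_eq_square)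
    ultimately have "((\<lambda>t. exp (- (1 / t)) * inverse t ^ k) has_field_derivative
            exp (- (1 / t)) * inverse t ^ 2 * inverse t ^ k
              + - (k * inverse t ^ (k + 1)) * exp (- (1 / t))) (at t)"
      using DERIV_mult by blast
    also have "exp (- (1 / t)) * inverse t ^ 2 * inverse t ^ k
              + - (k * inverse t ^ (k + 1)) * exp (- (1 / t)) = flat (k + 2) t - k * flat (k + 1) t"
      using 1 by (simp add: flat_def power2_eq_square field_simps)
    finally have "((\<lambda>t. exp (- (1 / t)) * inverse t ^ k) has_field_derivative
            flat (k + 2) t - k * flat (k + 1) t) (at t)" .
    moreover have ev: "eventually (\<lambda>u. exp (- (1 / u)) * inverse u ^ k = flat k u) (nhds t)"
      using eventually_nhds_in_open[of "{0<..}" t] 1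
      by (auto elim!: eventually_mono simp: flat_def divide_inverse power_inverse)
    ultimately show ?thesis
      using DERIV_cong_ev[OF refl ev refl] by simp
  next
    case 2
    have "((\<lambda>t. 0) has_field_derivative flat (k + 2) t - k * flat (k + 1) t) (at t)"
      using 2 by (simp add: flat_def)
    moreover have ev: "eventually (\<lambda>u. 0 = flat k u) (nhds t)"
      using eventually_nhds_in_open[of "{..<0}" t] 2
      by (auto elim!: eventually_mono simp: flat_def)
    ultimately show ?thesis
      using DERIV_cong_ev[OF refl ev refl] by simp
  next
    case 3
    have "eventually (\<lambda>h. flat (Suc k) h = (flat k (0 + h) - flat k 0) / h) (at 0)"
      by (simp add: flat_def eventually_at_filter)
    then have "((\<lambda>h. (flat k (0 + h) - flat k 0) / h) \<longlongrightarrow> 0) (at 0)"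
      by (rule Lim_transform_eventually[OF flat_tendsto_0])
    then show ?thesis using 3 by (simp add: DERIV_def flat_def)
  qed
qed

text \<open>
  An algebra of functions that contains a bump function with centre \<open>z\<close> and radius \<open>r\<close> and
  is closed under directional derivatives. Since the recursion in \<^const>\<open>Ck\<close> asks for
  exactly such derivatives, all its members are smooth.
\<close>

inductive bump_algebra :: "'a::euclidean_space \<Rightarrow> real \<Rightarrow> ('a \<Rightarrow> real) \<Rightarrow> bool" for z r where
  const: "bump_algebra z r (\<lambda>x. c)"
| inner: "bump_algebra z r (\<lambda>x. x \<bullet> b)"
| flat: "bump_algebra z r (\<lambda>x. flat k (r\<^sup>2 - (x - z) \<bullet> (x - z)))"
| add: "bump_algebra z r f \<Longrightarrow> bump_algebra z r g \<Longrightarrow> bump_algebra z r (\<lambda>x. f x + g x)"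
| mult: "bump_algebra z r f \<Longrightarrow> bump_algebra z r g \<Longrightarrow> bump_algebra z r (\<lambda>x. f x * g x)"

lemma bump_algebra_derivative:
  assumes "bump_algebra z r f"
  shows "\<exists>f'. (\<forall>x. (f has_derivative f' x) (at x)) \<and> (\<forall>h. bump_algebra z r (\<lambda>x. f' x h))"
  using assms
proof induction
  case (const c)
  show ?case
    by (rule exI[of _ "\<lambda>x h. 0"]) (auto intro: bump_algebra.const)
next
  case (inner b)
  show ?case
    by (rule exI[of _ "\<lambda>x h. h \<bullet> b"])
       (auto intro!: bump_algebra.const derivative_eq_intros)
next
  case (flat k)
  let ?q = "\<lambda>x. r\<^sup>2 - (x - z) \<bullet> (x - z)"
  let ?D = "\<lambda>x h. (flat (k + 2) (?q x) + (- real k) * flat (k + 1) (?q x)) *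
                    ((-2) * (x \<bullet> h + (- (z \<bullet> h))))"
  have q: "(?q has_derivative (\<lambda>h. (-2) * (x \<bullet> h + (- (z \<bullet> h))))) (at x)" for x
    by (rule derivative_eq_intros refl | simp add: inner_diff inner_commute algebra_simps)+
  have "((\<lambda>x. flat k (?q x)) has_derivative ?D x) (at x)" for x
    using has_derivative_compose[OF q,
        OF flat_has_field_derivative[of k "?q x", unfolded has_field_derivative_def]]
    by simp
  moreover have "bump_algebra z r (\<lambda>x. ?D x h)" for h
    by (intro bump_algebra.intros)
  ultimately show ?case by (intro exI[of _ ?D]) blast
next
  case (add f g)
  then obtain f' g' where "\<forall>x. (f has_derivative f' x) (at x)" "\<forall>h. bump_algebra z r (\<lambda>x. f' x h)"
    "\<forall>x. (g has_derivative g' x) (at x)" "\<forall>h. bump_algebra z r (\<lambda>x. g' x h)"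
    by blast
  then show ?case
    by (intro exI[of _ "\<lambda>x h. f' x h + g' x h"])
       (auto intro!: bump_algebra.add has_derivative_add)
next
  case (mult f g)
  then obtain f' g' where "\<forall>x. (f has_derivative f' x) (at x)" "\<forall>h. bump_algebra z r (\<lambda>x. f' x h)"
    "\<forall>x. (g has_derivative g' x) (at x)" "\<forall>h. bump_algebra z r (\<lambda>x. g' x h)"
    by blast
  then show ?case using mult.hyps
    by (intro exI[of _ "\<lambda>x h. f x * g' x h + f' x h * g x"])
       (auto intro!: bump_algebra.intros has_derivative_mult)
qed

lemma bump_algebra_imp_smooth:
  assumes "bump_algebra z r f"
  shows "smooth f"
proof -
  have "Ck k f" for k using assms
  proof (induction k arbitrary: f)
    case 0
    then obtain f' where "\<And>x. (f has_derivative f' x) (at x)"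
      using bump_algebra_derivative by blast
    then show ?case
      by (auto intro!: continuous_at_imp_continuous_on intro: has_derivative_continuous)
  next
    case (Suc k)
    obtain f' where f': "\<And>x. (f has_derivative f' x) (at x)" "\<And>h. bump_algebra z r (\<lambda>x. f' x h)"
      using bump_algebra_derivative[OF Suc.prems] by blast
    then have "frechet_derivative f (at x) = f' x" for x
      by (metis frechet_derivative_at)
    with f' Suc.IH show ?case
      by (auto simp: differentiable_on_def differentiable_def)
  qed
  then show ?thesis by (simp add: smooth_def)
qed

definition bump :: "'a::euclidean_space \<Rightarrow> real \<Rightarrow> 'a \<Rightarrow> real" where
  "bump z r x = flat 0 (r\<^sup>2 - (x - z) \<bullet> (x - z))"

lemma bump_eq_0_iff: "r > 0 \<Longrightarrow> bump z r x = 0 \<longleftrightarrow> x \<notin> ball z r"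
proof -
  assume "r > 0"
  then have "(x - z) \<bullet> (x - z) < r\<^sup>2 \<longleftrightarrow> norm (x - z) < r"
    unfolding power2_norm_eq_inner[symmetric]
    by (meson less_imp_le norm_ge_zero power2_less_imp_less power_strict_mono zero_less_numeral)
  then show ?thesis
    by (simp add: bump_def flat_def dist_norm norm_minus_commute)
qed

lemma bump_nonneg: "bump z r x \<ge> 0"
  by (simp add: bump_def flat_def)

lemma bump_le_1: "bump z r x \<le> 1"
  by (simp add: bump_def flat_def)

lemma bump_smooth: "smooth (bump z r)"
  by (rule bump_algebra_imp_smooth[of z r])
     (unfold bump_def[abs_def], rule bump_algebra.flat)

lemma bump_in_test_functions:
  assumes "r > 0" "cball z r \<subseteq> U"
  shows "bump z r \<in> test_functions U"
proof -
  have "{x. bump z r x \<noteq> 0} = ball z r"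
    using assms(1) by (auto simp: bump_eq_0_iff)
  then show ?thesis
    using assms bump_smooth by (simp add: test_functions_def)
qed

lemma bump_continuous: "continuous_on UNIV (bump z r)"
proof -
  have "Ck 0 (bump z r)" using bump_smooth unfolding smooth_def by blast
  then show ?thesis by simp
qed

lemma bump_integrable: "r > 0 \<Longrightarrow> integrable lebesgue (bump z r)"
proof -
  assume r: "r > 0"
  have "bump z r \<in> borel_measurable borel"
    by (rule borel_measurable_continuous_onI[OF bump_continuous])
  then have m: "bump z r \<in> borel_measurable lebesgue"
    by (intro measurable_completion) simp
  show "integrable lebesgue (bump z r)"
  proof (rule Bochner_Integration.integrable_bound[OF _ m])
    show "integrable lebesgue (indicat_real (ball z r))"
      by (intro integrable_real_indicator) (use emeasure_bounded_finite[OF bounded_ball] in auto)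
    show "AE x in lebesgue. norm (bump z r x) \<le> norm (indicat_real (ball z r) x)"
    proof (intro AE_I2)
      fix x
      show "norm (bump z r x) \<le> norm (indicat_real (ball z r) x)"
        using bump_nonneg[of z r x] bump_le_1[of z r x] bump_eq_0_iff[OF r, of z x]
        by (auto simp: indicator_def)
    qed
  qed
qed

section \<open>Integral operators whose kernel is singular only on the diagonal\<close>

text \<open>
  Convolution kernels that are bounded away from the origin. Applied to a function which vanishes
  near \<open>x\<close>, their singularity is invisible from \<open>x\<close>.
\<close>

definition tame_kernel :: "('a::euclidean_space \<Rightarrow> real) \<Rightarrow> bool" where
  "tame_kernel K \<longleftrightarrow> K \<in> borel_measurable borel \<and> (\<forall>r>0. \<exists>M. \<forall>x. r \<le> norm x \<longrightarrow> \<bar>K x\<bar> \<le> M)"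

definition conv :: "('a::euclidean_space \<Rightarrow> real) \<Rightarrow> ('a \<Rightarrow> real) \<Rightarrow> 'a \<Rightarrow> real" where
  "conv w K x = (LINT y|lebesgue. w y * K (x - y))"

lemma tame_kernel_measurable_shift:
  assumes "tame_kernel K"
  shows "(\<lambda>y. K (x - y)) \<in> borel_measurable lebesgue"
proof -
  have [measurable]: "K \<in> borel_measurable borel"
    using assms by (simp add: tame_kernel_def)
  have "(\<lambda>y. K (x - y)) \<in> borel_measurable lborel" by measurable
  then show ?thesis by (rule measurable_completion)
qed

text \<open>
  The domination behind every limit taken below. If \<open>w\<close> vanishes on a ball around \<open>x\<close> of twice
  the radius, then for \<open>x'\<close> in the smaller ball the kernel is only evaluated at distance at least
  \<open>r\<close> from its singularity, so one integrable majorant serves all such \<open>x'\<close>.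
\<close>

lemma tame_kernel_uniform_bound:
  assumes "tame_kernel K" "open U" "x \<in> U" and w0: "\<And>y. y \<in> U \<Longrightarrow> w y = 0"
  obtains r M where "r > 0" "ball x (2 * r) \<subseteq> U"
    "\<And>x' y. x' \<in> ball x r \<Longrightarrow> \<bar>w y * K (x' - y)\<bar> \<le> M * \<bar>w y\<bar>"
proof -
  obtain e where e: "e > 0" "ball x e \<subseteq> U"
    using assms(2,3) by (meson open_contains_ball)
  define r where "r = e / 2"
  have r: "r > 0" "ball x (2 * r) \<subseteq> U"
    using e by (auto simp: r_def)
  obtain M where M: "\<And>z. r \<le> norm z \<Longrightarrow> \<bar>K z\<bar> \<le> M"
    using assms(1) r(1) unfolding tame_kernel_def by blast
  have "\<bar>w y * K (x' - y)\<bar> \<le> M * \<bar>w y\<bar>" if x': "x' \<in> ball x r" for x' y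
  proof (cases "y \<in> U")
    case False
    then have "dist x y \<ge> 2 * r"
      using r(2) by (meson linorder_not_less mem_ball subsetD)
    moreover have "dist x y \<le> dist x x' + dist x' y" by (rule dist_triangle)
    ultimately have "r \<le> norm (x' - y)"
      using x' by (simp add: dist_norm)
    then show ?thesis
      using mult_right_mono[OF M, of "x' - y" "\<bar>w y\<bar>"] by (simp add: abs_mult mult.commute)
  qed (simp add: w0)
  with r show ?thesis by (rule that)
qed

lemma integrable_conv:
  assumes K: "tame_kernel K" and w: "integrable lebesgue w"
    and "open U" "x \<in> U" "\<And>y. y \<in> U \<Longrightarrow> w y = 0"
  shows "integrable lebesgue (\<lambda>y. w y * K (x - y))"
proof -
  obtain r M where r: "r > 0" "ball x (2 * r) \<subseteq> U"
    "\<And>x' y. x' \<in> ball x r \<Longrightarrow> \<bar>w y * K (x' - y)\<bar> \<le> M * \<bar>w y\<bar>"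
    using tame_kernel_uniform_bound[where w = w, OF K assms(3-5)] by blast
  show ?thesis
  proof (rule Bochner_Integration.integrable_bound[of _ "\<lambda>y. M * \<bar>w y\<bar>"])
    show "AE y in lebesgue. norm (w y * K (x - y)) \<le> norm (M * \<bar>w y\<bar>)"
    proof (intro AE_I2)
      fix y
      have "\<bar>w y * K (x - y)\<bar> \<le> M * \<bar>w y\<bar>"
        using r(1) by (intro r(3)) simp
      then show "norm (w y * K (x - y)) \<le> norm (M * \<bar>w y\<bar>)"
        unfolding real_norm_def by linarith
    qed
  qed (use w tame_kernel_measurable_shift[OF K] in auto)
qed

lemma conv_isCont:
  assumes K: "tame_kernel K" and w: "integrable lebesgue w"
    and U: "open U" "x \<in> U" "\<And>y. y \<in> U \<Longrightarrow> w y = 0"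
    and cont: "continuous_on (- {0}) K"
  shows "isCont (conv w K) x"
  unfolding continuous_at_sequentially
proof safe
  fix X assume X: "X \<longlonglongrightarrow> x"
  obtain r M where r: "r > 0" "ball x (2 * r) \<subseteq> U"
    "\<And>x' y. x' \<in> ball x r \<Longrightarrow> \<bar>w y * K (x' - y)\<bar> \<le> M * \<bar>w y\<bar>"
    using tame_kernel_uniform_bound[where w = w, OF K U] by blast
  obtain N where N: "\<And>n. n \<ge> N \<Longrightarrow> X n \<in> ball x r"
    using X r(1) by (metis lim_sequentially dist_commute mem_ball)
  have "(\<lambda>n. conv w K (X (n + N))) \<longlonglongrightarrow> conv w K x"
    unfolding conv_def
  proof (rule integral_dominated_convergence[where w = "\<lambda>y. M * \<bar>w y\<bar>"])
    show "AE y in lebesgue. (\<lambda>n. w y * K (X (n + N) - y)) \<longlonglongrightarrow> w y * K (x - y)"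
    proof (intro AE_I2)
      fix y
      show "(\<lambda>n. w y * K (X (n + N) - y)) \<longlonglongrightarrow> w y * K (x - y)"
      proof (cases "y = x")
        case False
        then have "isCont K (x - y)"
          using cont by (simp add: continuous_on_eq_continuous_at open_Compl)
        moreover have "(\<lambda>n. X (n + N) - y) \<longlonglongrightarrow> x - y"
          by (rule tendsto_diff[OF LIMSEQ_ignore_initial_segment[OF X] tendsto_const])
        ultimately show ?thesis
          by (rule tendsto_mult[OF tendsto_const isCont_tendsto_compose])
      qed (use U in auto)
    qed
    show "AE y in lebesgue. norm (w y * K (X (n + N) - y)) \<le> M * \<bar>w y\<bar>" for n
      using r(3)[OF N[of "n + N"]] by (intro AE_I2) simp
  qed (use w tame_kernel_measurable_shift[OF K] in auto)
  then show "(conv w K \<circ> X) \<longlonglongrightarrow> conv w K x"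
    unfolding o_def by (rule LIMSEQ_offset)
qed

text \<open>
  Differentiation under the integral sign, in the only form needed: all difference quotients of
  the potential inside \<open>U\<close> are zero, and they converge to the potential of the differentiated
  kernel.
\<close>

lemma conv_directional_derivative_eq_0:
  fixes b :: "'a::euclidean_space"
  assumes K: "tame_kernel K" and K': "tame_kernel K'" and w: "integrable lebesgue w"
    and U: "open U" "x \<in> U" "\<And>y. y \<in> U \<Longrightarrow> w y = 0"
    and b: "norm b = 1"
    and der: "\<And>z. z \<noteq> 0 \<Longrightarrow> ((\<lambda>t. K (z + t *\<^sub>R b)) has_field_derivative K' z) (at 0)"
    and zero: "\<And>x. x \<in> U \<Longrightarrow> conv w K x = 0"
  shows "conv w K' x = 0"
proof -
  obtain r M where r: "r > 0" "ball x (2 * r) \<subseteq> U"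
    "\<And>x' y. x' \<in> ball x r \<Longrightarrow> \<bar>w y * K' (x' - y)\<bar> \<le> M * \<bar>w y\<bar>"
    using tame_kernel_uniform_bound[where w = w, OF K' U] by blast
  \<comment> \<open>steps so short that the segment from x to x + h n b stays in the ball of radius r\<close>
  define h where "h n = r / 2 * inverse (real (Suc n))" for n
  have h: "0 < h n" "h n < r" for n
    using r(1) by (auto simp: h_def field_simps add_pos_nonneg)
  have h0: "h \<longlonglongrightarrow> 0"
    unfolding h_def by (rule tendsto_mult_right_zero[OF LIMSEQ_inverse_real_of_nat])
  define Q where "Q n y = w y * ((K (x + h n *\<^sub>R b - y) - K (x - y)) / h n)" for n y
  have inU: "x + t *\<^sub>R b \<in> ball x r" if "\<bar>t\<bar> < r" for t
    using that b by (simp add: dist_norm)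
  have ballU: "ball x r \<subseteq> U"
    using r(1,2) by auto
  have Q0: "integral\<^sup>L lebesgue (Q n) = 0" for n
  proof -
    have xh: "x + h n *\<^sub>R b \<in> U"
      using inU[of "h n"] h[of n] ballU by auto
    have "Q n = (\<lambda>y. (w y * K (x + h n *\<^sub>R b - y) - w y * K (x - y)) / h n)"
      by (simp add: Q_def fun_eq_iff algebra_simps diff_divide_distrib)
    then have "integral\<^sup>L lebesgue (Q n) = (conv w K (x + h n *\<^sub>R b) - conv w K x) / h n"
      using integrable_conv[OF K w U(1) xh U(3)] integrable_conv[OF K w U] by (simp add: conv_def)
    then show ?thesis
      using zero[OF U(2)] zero[OF xh] by simp
  qed
  have bound: "\<bar>Q n y\<bar> \<le> M * \<bar>w y\<bar>" for n y
  proof (cases "y \<in> U")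
    case False
    have "\<exists>t. 0 < t \<and> t < h n \<and>
        K (x - y + h n *\<^sub>R b) - K (x - y + 0 *\<^sub>R b) = (h n - 0) * K' (x - y + t *\<^sub>R b)"
    proof (rule MVT2)
      fix t assume t: "0 \<le> t" "t \<le> h n"
      then have "x + t *\<^sub>R b \<in> U"
        using inU[of t] h[of n] ballU by auto
      then have "x - y + t *\<^sub>R b \<noteq> 0"
        using False by (auto simp: algebra_simps)
      from der[OF this] show "((\<lambda>t. K (x - y + t *\<^sub>R b)) has_field_derivative K' (x - y + t *\<^sub>R b)) (at t)"
        using DERIV_shift[of "\<lambda>t. K (x - y + t *\<^sub>R b)" "K' (x - y + t *\<^sub>R b)" 0 t]
        by (simp add: algebra_simps)
    qed (use h in auto)
    then obtain t where t: "0 < t" "t < h n"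
      "K (x - y + h n *\<^sub>R b) - K (x - y) = h n * K' (x - y + t *\<^sub>R b)"
      by auto
    then have "Q n y = w y * K' (x + t *\<^sub>R b - y)"
      using h[of n] by (simp add: Q_def algebra_simps)
    then show ?thesis
      using r(3)[OF inU[of t], of y] t h[of n] by simp
  qed (simp add: Q_def U)
  have "(\<lambda>n. integral\<^sup>L lebesgue (Q n)) \<longlonglongrightarrow> conv w K' x"
    unfolding conv_def
  proof (rule integral_dominated_convergence[where w = "\<lambda>y. M * \<bar>w y\<bar>"])
    show "AE y in lebesgue. (\<lambda>n. Q n y) \<longlonglongrightarrow> w y * K' (x - y)"
    proof (intro AE_I2)
      fix y
      show "(\<lambda>n. Q n y) \<longlonglongrightarrow> w y * K' (x - y)"
      proof (cases "y = x")
        case False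
        then have "((\<lambda>t. (K (x - y + t *\<^sub>R b) - K (x - y)) / t) \<longlongrightarrow> K' (x - y)) (at 0)"
          using der[of "x - y"] by (simp add: DERIV_def)
        moreover have "filterlim h (at 0) sequentially"
          using h0 h(1) by (auto simp: filterlim_at intro!: always_eventually less_imp_neq[THEN not_sym])
        ultimately have "(\<lambda>n. (K (x - y + h n *\<^sub>R b) - K (x - y)) / h n) \<longlonglongrightarrow> K' (x - y)"
          by (rule filterlim_compose)
        then have "(\<lambda>n. w y * ((K (x - y + h n *\<^sub>R b) - K (x - y)) / h n)) \<longlonglongrightarrow> w y * K' (x - y)"
          by (intro tendsto_mult tendsto_const)
        then show ?thesis by (simp add: Q_def algebra_simps)
      qed (use U in \<open>auto simp: Q_def\<close>)
    qed
    show "Q n \<in> borel_measurable lebesgue" for n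
      unfolding Q_def using w tame_kernel_measurable_shift[OF K]
      by (intro borel_measurable_times borel_measurable_divide borel_measurable_diff) auto
    show "AE y in lebesgue. norm (Q n y) \<le> M * \<bar>w y\<bar>" for n
      using bound by (intro AE_I2) simp
  qed (use w tame_kernel_measurable_shift[OF K'] in auto)
  then show ?thesis
    by (simp add: Q0 LIMSEQ_const_iff)
qed

section \<open>Riesz potentials that vanish on an open set\<close>

lemma tame_kernel_powr_bound:
  assumes "K \<in> borel_measurable borel" "p \<le> 0"
    and "\<And>z. z \<noteq> 0 \<Longrightarrow> \<bar>K z\<bar> \<le> c * (norm z powr p)"
  shows "tame_kernel K"
  unfolding tame_kernel_def
proof (intro conjI allI impI)
  fix r :: real assume r: "r > 0"
  have "\<bar>K z\<bar> \<le> \<bar>c\<bar> * (r powr p)" if z: "r \<le> norm z" for z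
  proof -
    have "\<bar>K z\<bar> \<le> c * (norm z powr p)"
      using z r by (intro assms(3)) auto
    also have "\<dots> \<le> \<bar>c\<bar> * (r powr p)"
      using z r assms(2) by (intro mult_mono powr_mono2') auto
    finally show ?thesis .
  qed
  then show "\<exists>M. \<forall>z. r \<le> norm z \<longrightarrow> \<bar>K z\<bar> \<le> M" by blast
qed (use assms in auto)

text \<open>
  The Riesz kernels are written as powers of the square of the norm, a polynomial, which is easier to
  differentiate than the norm.
\<close>

lemma inner_self_powr: "(z \<bullet> z) powr q = norm z powr (2 * q)"
proof -
  have "z \<bullet> z = norm z powr 2"
    by (cases "z = 0") (simp_all add: power2_norm_eq_inner)
  then show ?thesis by (simp only: powr_powr)
qed

lemma tame_riesz: "q \<le> 0 \<Longrightarrow> tame_kernel (\<lambda>z::'a::euclidean_space. (z \<bullet> z) powr q)"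
  by (rule tame_kernel_powr_bound[where p = "2 * q" and c = 1]) (auto simp: inner_self_powr)

lemma tame_riesz_derivative:
  fixes b :: "'a::euclidean_space"
  assumes "q \<le> 0" "norm b = 1"
  shows "tame_kernel (\<lambda>z. 2 * q * (z \<bullet> b) * (z \<bullet> z) powr (q - 1))"
proof (rule tame_kernel_powr_bound[where p = "2 * q - 1" and c = "2 * \<bar>q\<bar>"])
  fix z :: 'a assume "z \<noteq> 0"
  have "\<bar>z \<bullet> b\<bar> \<le> norm z"
    using Cauchy_Schwarz_ineq2[of z b] assms by simp
  then have "\<bar>2 * q * (z \<bullet> b) * (z \<bullet> z) powr (q - 1)\<bar>
      \<le> 2 * \<bar>q\<bar> * (norm z * norm z powr (2 * q - 2))"
    by (auto simp: abs_mult inner_self_powr mult.assoc algebra_simps intro!: mult_left_mono mult_right_mono)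
  also have "norm z * norm z powr (2 * q - 2) = norm z powr (2 * q - 1)"
    using \<open>z \<noteq> 0\<close> by (simp add: powr_mult_base)
  finally show "\<bar>2 * q * (z \<bullet> b) * (z \<bullet> z) powr (q - 1)\<bar> \<le> 2 * \<bar>q\<bar> * (norm z powr (2 * q - 1))" .
qed (use assms in auto)

lemma tame_riesz_second_derivative:
  fixes b :: "'a::euclidean_space"
  assumes "q \<le> 0" "norm b = 1"
  shows "tame_kernel (\<lambda>z. 2 * q * (z \<bullet> z) powr (q - 1)
            + 4 * q * (q - 1) * (z \<bullet> b)\<^sup>2 * (z \<bullet> z) powr (q - 2))"
proof (rule tame_kernel_powr_bound[where p = "2 * q - 2" and c = "2 * \<bar>q\<bar> + 4 * \<bar>q * (q - 1)\<bar>"])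
  fix z :: 'a assume z: "z \<noteq> 0"
  have "(z \<bullet> b)\<^sup>2 \<le> (norm z)\<^sup>2"
    using Cauchy_Schwarz_ineq2[of z b] assms by (simp flip: abs_le_square_iff)
  then have "\<bar>4 * q * (q - 1) * (z \<bullet> b)\<^sup>2 * (z \<bullet> z) powr (q - 2)\<bar>
      \<le> 4 * \<bar>q * (q - 1)\<bar> * ((norm z)\<^sup>2 * norm z powr (2 * q - 4))"
    by (simp add: abs_mult inner_self_powr mult.assoc mult_left_mono mult_right_mono)
  also have "(norm z)\<^sup>2 * norm z powr (2 * q - 4) = norm z powr (2 * q - 2)"
    using z by (simp add: powr_add[symmetric] flip: powr_numeral)
  finally show "\<bar>2 * q * (z \<bullet> z) powr (q - 1) + 4 * q * (q - 1) * (z \<bullet> b)\<^sup>2 * (z \<bullet> z) powr (q - 2)\<bar>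
      \<le> (2 * \<bar>q\<bar> + 4 * \<bar>q * (q - 1)\<bar>) * (norm z powr (2 * q - 2))"
    by (intro order_trans[OF abs_triangle_ineq])
       (simp add: abs_mult inner_self_powr algebra_simps)
qed (use assms in auto)

lemma riesz_has_derivative:
  fixes b z :: "'a::euclidean_space"
  assumes "norm b = 1" "z \<noteq> 0"
  shows "((\<lambda>t. ((z + t *\<^sub>R b) \<bullet> (z + t *\<^sub>R b)) powr q) has_field_derivative
            2 * q * (z \<bullet> b) * (z \<bullet> z) powr (q - 1)) (at 0)"
proof -
  have "((\<lambda>t. (z + t *\<^sub>R b) \<bullet> (z + t *\<^sub>R b)) has_field_derivative 2 * (z \<bullet> b)) (at 0)"
    unfolding inner_add
    by (auto intro!: derivative_eq_intros simp: inner_commute)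
  from DERIV_fun_powr[OF this, of q] assms(2) show ?thesis
    by (simp add: mult_ac)
qed

lemma riesz_has_second_derivative:
  fixes b z :: "'a::euclidean_space"
  assumes "norm b = 1" "z \<noteq> 0"
  shows "((\<lambda>t. 2 * q * ((z + t *\<^sub>R b) \<bullet> b) * ((z + t *\<^sub>R b) \<bullet> (z + t *\<^sub>R b)) powr (q - 1))
           has_field_derivative 2 * q * (z \<bullet> z) powr (q - 1)
            + 4 * q * (q - 1) * (z \<bullet> b)\<^sup>2 * (z \<bullet> z) powr (q - 2)) (at 0)"
proof -
  have "((\<lambda>t. 2 * q * ((z + t *\<^sub>R b) \<bullet> b)) has_field_derivative 2 * q) (at 0)"
    using assms(1) by (auto intro!: derivative_eq_intros simp: inner_add dot_square_norm)
  from DERIV_mult[OF this riesz_has_derivative[OF assms, of "q - 1"]]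
  show ?thesis
    by (simp add: algebra_simps power2_eq_square)
qed

text \<open>
  The Laplacian raises a Riesz kernel to the next one. In terms of the exponent \<open>s = -2q\<close> of the
  norm, the factor is \<open>s (s + 2 - n)\<close>; at the origin both sides are zero by the convention for
  \<^term>\<open>0 powr q\<close>.
\<close>

lemma riesz_laplacian:
  fixes z :: "'a::euclidean_space"
  shows "(\<Sum>b\<in>Basis. 2 * q * (z \<bullet> z) powr (q - 1) + 4 * q * (q - 1) * (z \<bullet> b)\<^sup>2 * (z \<bullet> z) powr (q - 2))
    = 2 * q * (real DIM('a) + 2 * q - 2) * (z \<bullet> z) powr (q - 1)"
proof -
  have "(\<Sum>b\<in>Basis. 4 * q * (q - 1) * (z \<bullet> b)\<^sup>2 * (z \<bullet> z) powr (q - 2))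
      = 4 * q * (q - 1) * ((z \<bullet> z) * (z \<bullet> z) powr (q - 2))"
    by (subst (2) euclidean_inner)
       (simp add: sum_distrib_left sum_distrib_right power2_eq_square mult.assoc)
  also have "(z \<bullet> z) * (z \<bullet> z) powr (q - 2) = (z \<bullet> z) powr (q - 1)"
    by (cases "z = 0") (simp_all add: powr_mult_base)
  finally show ?thesis
    unfolding sum.distrib by (simp add: algebra_simps)
qed

text \<open>
  Since the potential vanishes throughout \<open>U\<close>, so does its Laplacian, which is a multiple of the
  potential with the next kernel. The assumption \<open>n + 2q \<noteq> 2\<close> excludes the fundamental solution of
  the Laplace equation, whose Laplacian carries no information.
\<close>

lemma riesz_raise_exponent:
  fixes w :: "'a::euclidean_space \<Rightarrow> real"
  assumes w: "integrable lebesgue w"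
    and U: "open U" "\<And>y. y \<in> U \<Longrightarrow> w y = 0"
    and q: "q < 0" "real DIM('a) + 2 * q \<noteq> 2"
    and zero: "\<And>x. x \<in> U \<Longrightarrow> conv w (\<lambda>z. (z \<bullet> z) powr q) x = 0"
    and x: "x \<in> U"
  shows "conv w (\<lambda>z. (z \<bullet> z) powr (q - 1)) x = 0"
proof -
  let ?K1 = "\<lambda>b z. 2 * q * (z \<bullet> b) * (z \<bullet> z) powr (q - 1)"
  let ?K2 = "\<lambda>b z. 2 * q * (z \<bullet> z) powr (q - 1)
            + 4 * q * (q - 1) * (z \<bullet> b)\<^sup>2 * (z \<bullet> z) powr (q - 2)"
  have q0: "q \<le> 0" using q by simp
  have K2: "conv w (?K2 b) x = 0" if b: "b \<in> Basis" for b
  proof -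
    have nb: "norm b = 1" using b by simp
    have "conv w (?K1 b) x = 0" if "x \<in> U" for x
      using conv_directional_derivative_eq_0[OF tame_riesz[OF q0] tame_riesz_derivative[OF q0 nb]
          w U(1) that U(2) nb riesz_has_derivative[OF nb] zero] .
    then show ?thesis
      using conv_directional_derivative_eq_0[OF tame_riesz_derivative[OF q0 nb]
          tame_riesz_second_derivative[OF q0 nb] w U(1) x U(2) nb
          riesz_has_second_derivative[OF nb]] by blast
  qed
  let ?c = "2 * q * (real DIM('a) + 2 * q - 2)"
  have "?c * conv w (\<lambda>z. (z \<bullet> z) powr (q - 1)) x
      = (LINT y|lebesgue. (\<Sum>b\<in>Basis. w y * ?K2 b (x - y)))"
    unfolding conv_def sum_distrib_left[symmetric] riesz_laplacian
    by (subst Bochner_Integration.integral_mult_right_zero[symmetric]) (simp add: mult_ac)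
  also have "\<dots> = (\<Sum>b\<in>Basis. conv w (?K2 b) x)"
    unfolding conv_def
    by (intro Bochner_Integration.integral_sum
          integrable_conv[OF tame_riesz_second_derivative[OF q0] w U(1) x U(2)]) auto
  also have "\<dots> = 0" using K2 by simp
  finally show ?thesis using q by simp
qed

text \<open>
  The two density arguments below share this step. A weighted error \<open>e H\<close> is allowed because
  polynomial approximation will be applied to a quotient by a Riesz kernel.
\<close>

lemma integral_eq_0_by_approximation:
  fixes w g H :: "'a \<Rightarrow> real"
  assumes g: "integrable M (\<lambda>y. w y * g y)" and H: "integrable M (\<lambda>y. \<bar>w y\<bar> * H y)"
    and approx: "\<And>e. e > 0 \<Longrightarrow> \<exists>h. integrable M (\<lambda>y. w y * h y) \<and> (LINT y|M. w y * h y) = 0 \<and>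
        (\<forall>y. w y \<noteq> 0 \<longrightarrow> \<bar>g y - h y\<bar> \<le> e * H y)"
  shows "(LINT y|M. w y * g y) = 0"
proof -
  define I where "I = \<bar>LINT y|M. w y * g y\<bar>"
  define B where "B = (LINT y|M. \<bar>w y\<bar> * H y)"
  have le: "I \<le> e * B" if e: "e > 0" for e
  proof -
    obtain h where h: "integrable M (\<lambda>y. w y * h y)" "(LINT y|M. w y * h y) = 0"
      "\<And>y. w y \<noteq> 0 \<Longrightarrow> \<bar>g y - h y\<bar> \<le> e * H y"
      using approx[OF e] by blast
    have "I = \<bar>LINT y|M. w y * g y - w y * h y\<bar>"
      using g h by (simp add: I_def)
    also have "\<dots> \<le> (LINT y|M. \<bar>w y * g y - w y * h y\<bar>)"
      by (rule integral_abs_bound)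
    also have "\<dots> \<le> (LINT y|M. e * (\<bar>w y\<bar> * H y))"
    proof (rule integral_mono)
      fix y
      have "\<bar>w y * g y - w y * h y\<bar> = \<bar>w y\<bar> * \<bar>g y - h y\<bar>"
        by (simp add: abs_mult flip: right_diff_distrib)
      also have "\<dots> \<le> \<bar>w y\<bar> * (e * H y)"
        using h(3) by (cases "w y = 0") (auto intro!: mult_left_mono)
      finally show "\<bar>w y * g y - w y * h y\<bar> \<le> e * (\<bar>w y\<bar> * H y)"
        by (simp add: mult_ac)
    qed (use g h H in auto)
    finally show ?thesis by (simp add: B_def)
  qed
  have "(\<lambda>n. inverse (real (Suc n)) * B) \<longlonglongrightarrow> 0"
    by (rule tendsto_mult_left_zero[OF LIMSEQ_inverse_real_of_nat])
  then have "I \<le> 0"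
    by (rule tendsto_lowerbound) (auto intro!: always_eventually le)
  then show ?thesis by (simp add: I_def)
qed

lemma integrable_times_continuous:
  fixes w g :: "'a::euclidean_space \<Rightarrow> real"
  assumes w: "integrable lebesgue w" and S: "compact S" "\<And>y. y \<notin> S \<Longrightarrow> w y = 0"
    and g: "continuous_on UNIV g"
  shows "integrable lebesgue (\<lambda>y. w y * g y)"
proof -
  have "compact (g ` S)"
    using compact_continuous_image[OF continuous_on_subset[OF g] S(1)] by simp
  then obtain M where M: "\<And>y. y \<in> S \<Longrightarrow> \<bar>g y\<bar> \<le> M"
    unfolding compact_eq_bounded_closed bounded_iff by auto
  have gm: "g \<in> borel_measurable lebesgue"
    using borel_measurable_continuous_onI[OF g] by (intro measurable_completion) simp
  show ?thesis
  proof (rule Bochner_Integration.integrable_bound[of _ "\<lambda>y. M * w y"])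
    show "AE y in lebesgue. norm (w y * g y) \<le> norm (M * w y)"
    proof (intro AE_I2)
      fix y
      show "norm (w y * g y) \<le> norm (M * w y)"
      proof (cases "y \<in> S")
        case True
        then have "\<bar>g y\<bar> \<le> \<bar>M\<bar>" using M by fastforce
        then show ?thesis
          by (simp add: abs_mult mult.commute mult_right_mono)
      qed (simp add: S)
    qed
  qed (use w gm in auto)
qed

text \<open>
  With \<open>\<tau> = \<bar>x - y\<bar>\<^sup>-\<^sup>2\<close> the hypothesis says that \<open>\<bar>x - y\<bar>\<^bsup>2q\<^esup> p(\<tau>)\<close> is orthogonal to \<open>w\<close> for every
  polynomial \<open>p\<close>. As \<open>w\<close> vanishes near \<open>x\<close> and outside a bounded set, \<open>\<tau>\<close> ranges over a compact
  interval \<open>J\<close> of positive numbers, on which polynomials are dense.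
\<close>

lemma radial_integral_eq_0:
  fixes w :: "'a::euclidean_space \<Rightarrow> real"
  assumes w: "integrable lebesgue w" and S: "compact S" "\<And>y. y \<notin> S \<Longrightarrow> w y = 0"
    and U: "open U" "x \<in> U" "\<And>y. y \<in> U \<Longrightarrow> w y = 0"
    and q: "q < 0"
    and zero: "\<And>k::nat. conv w (\<lambda>z. (z \<bullet> z) powr (q - real k)) x = 0"
    and f: "continuous_on UNIV f"
  shows "(LINT y|lebesgue. w y * f ((x - y) \<bullet> (x - y))) = 0"
proof -
  define d where "d y = (x - y) \<bullet> (x - y)" for y
  obtain e where e: "e > 0" "ball x e \<subseteq> U"
    using U by (meson open_contains_ball)
  obtain R where R: "R > 0" "\<And>y. y \<in> S \<Longrightarrow> norm (x - y) \<le> R"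
    using bounded_subset_ballD[OF compact_imp_bounded[OF S(1)], of x]
    by (auto simp: dist_norm subset_iff less_imp_le)
  have d: "e\<^sup>2 \<le> d y" "d y \<le> R\<^sup>2" if "w y \<noteq> 0" for y
  proof -
    have "y \<in> S" "y \<notin> ball x e" using that S U e by blast+
    then have "e \<le> norm (x - y)" "norm (x - y) \<le> R"
      using R(2) by (auto simp: dist_norm)
    then show "e\<^sup>2 \<le> d y" "d y \<le> R\<^sup>2"
      using e(1) unfolding d_def power2_norm_eq_inner[symmetric] by (auto intro!: power_mono)
  qed
  define J where "J = {1 / R\<^sup>2 .. 1 / e\<^sup>2}"
  have pos: "\<tau> > 0" if "\<tau> \<in> J" for \<tau>
    using that R(1) by (auto simp: J_def intro: less_le_trans[rotated])
  \<comment> \<open>the function of tau which, multiplied by the kernel, gives f; it is g that polynomials approximate\<close>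
  define g where "g \<tau> = f (1 / \<tau>) * \<tau> powr q" for \<tau>
  have "continuous_on J (\<lambda>\<tau>. f (1 / \<tau>))"
    using pos by (intro continuous_on_compose2[OF f]) (force intro!: continuous_intros)+
  then have gc: "continuous_on J g"
    unfolding g_def using pos by (intro continuous_intros) force+
  have int: "integrable lebesgue (\<lambda>y. w y * d y powr (q - real k))" for k
    using integrable_conv[OF tame_riesz w U, of "q - real k"] q by (simp add: d_def)
  have "(LINT y|lebesgue. w y * f (d y)) = 0"
  proof (rule integral_eq_0_by_approximation[where H = "\<lambda>y. d y powr q"])
    show "integrable lebesgue (\<lambda>y. w y * f (d y))"
      unfolding d_def
      by (intro integrable_times_continuous[OF w S] continuous_on_compose2[OF f] continuous_intros) auto
    show "integrable lebesgue (\<lambda>y. \<bar>w y\<bar> * d y powr q)"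
      using integrable_abs[OF int[of 0]] by (simp add: abs_mult)
  next
    fix \<epsilon> :: real assume "\<epsilon> > 0"
    then obtain p where p: "real_polynomial_function p" "\<And>\<tau>. \<tau> \<in> J \<Longrightarrow> \<bar>g \<tau> - p \<tau>\<bar> < \<epsilon>"
      using Stone_Weierstrass_real_polynomial_function[of J g] gc by (auto simp: J_def)
    obtain c n where c: "p = (\<lambda>\<tau>. \<Sum>i\<le>n. c i * \<tau> ^ i)"
      using p(1) unfolding real_polynomial_function_iff_sum by blast
    define h where "h y = (\<Sum>i\<le>n. c i * d y powr (q - real i))" for y
    have h: "(\<lambda>y. w y * h y) = (\<lambda>y. \<Sum>i\<le>n. c i * (w y * d y powr (q - real i)))"
      by (simp add: h_def sum_distrib_left mult_ac)
    have "\<bar>f (d y) - h y\<bar> \<le> \<epsilon> * d y powr q" if y: "w y \<noteq> 0" for y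
    proof -
      have dpos: "d y > 0"
        using d(1)[OF y] e(1) by (meson less_le_trans zero_less_power)
      have J: "1 / d y \<in> J"
        using d[OF y] dpos e(1) R(1) by (auto simp: J_def field_simps)
      have "h y = d y powr q * p (1 / d y)"
        using dpos by (simp add: h_def c sum_distrib_left powr_diff powr_realpow power_divide mult_ac)
      moreover have "f (d y) = d y powr q * g (1 / d y)"
        using dpos by (simp add: g_def powr_divide)
      ultimately have "\<bar>f (d y) - h y\<bar> = d y powr q * \<bar>g (1 / d y) - p (1 / d y)\<bar>"
        by (simp add: abs_mult flip: right_diff_distrib)
      also have "\<dots> \<le> d y powr q * \<epsilon>"
        using p(2)[OF J] by (intro mult_left_mono) auto
      finally show ?thesis by (simp add: mult.commute)
    qed
    moreover have "integrable lebesgue (\<lambda>y. w y * h y)"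
      unfolding h using int by auto
    moreover have "(LINT y|lebesgue. w y * h y) = 0"
      unfolding h using int zero by (simp add: conv_def d_def)
    ultimately show "\<exists>h. integrable lebesgue (\<lambda>y. w y * h y) \<and> (LINT y|lebesgue. w y * h y) = 0 \<and>
        (\<forall>y. w y \<noteq> 0 \<longrightarrow> \<bar>f (d y) - h y\<bar> \<le> \<epsilon> * d y powr q)"
      by blast
  qed
  then show ?thesis by (simp add: d_def)
qed

section \<open>Sums of Gaussians and unique continuation for Riesz potentials\<close>

text \<open>
  The width \<open>l = 0\<close> is admitted so that the constants are included.
\<close>

inductive gaussian_sum :: "'a::euclidean_space set \<Rightarrow> ('a \<Rightarrow> real) \<Rightarrow> bool" for B where
  gaussian: "x \<in> B \<Longrightarrow> 0 \<le> l \<Longrightarrow> gaussian_sum B (\<lambda>y. c * exp (- (l * ((x - y) \<bullet> (x - y)))))"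
| add: "gaussian_sum B f \<Longrightarrow> gaussian_sum B g \<Longrightarrow> gaussian_sum B (\<lambda>y. f y + g y)"

lemma gaussian_sum_continuous: "gaussian_sum B f \<Longrightarrow> continuous_on UNIV f"
  by (induction rule: gaussian_sum.induct) (intro continuous_intros; assumption?)+

text \<open>
  Completing the square: the weighted sum of the squared distances to \<open>x\<close> and \<open>x'\<close> is, up to an
  additive constant, a multiple of the squared distance to the weighted mean of \<open>x\<close> and \<open>x'\<close>. This is where
  convexity of the set of centres enters.
\<close>

lemma gaussian_product:
  fixes x x' :: "'a::euclidean_space"
  assumes "convex B" "x \<in> B" "x' \<in> B" "0 \<le> l" "0 \<le> l'"
  shows "gaussian_sum B (\<lambda>y. (c * exp (- (l * ((x - y) \<bullet> (x - y))))) *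
                            (c' * exp (- (l' * ((x' - y) \<bullet> (x' - y))))))"
proof (cases "l + l' = 0")
  case True
  then have "l = 0" "l' = 0" using assms by auto
  then show ?thesis
    using gaussian_sum.gaussian[OF assms(2), of 0 "c * c'"] by simp
next
  case False
  define m where "m = l + l'"
  have m: "m > 0" using False assms by (simp add: m_def)
  define xm where "xm = (l / m) *\<^sub>R x + (l' / m) *\<^sub>R x'"
  have "xm \<in> B"
    using assms m unfolding xm_def by (intro convexD) (auto simp: m_def simp flip: add_divide_distrib)
  define d where "d = l * (x \<bullet> x) + l' * (x' \<bullet> x') - m * (xm \<bullet> xm)"
  have mxm: "m *\<^sub>R xm = l *\<^sub>R x + l' *\<^sub>R x'"
    using m by (simp add: xm_def scaleR_add_right)
  have eq: "l * ((x - y) \<bullet> (x - y)) + l' * ((x' - y) \<bullet> (x' - y)) = m * ((xm - y) \<bullet> (xm - y)) + d" for y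
  proof -
    have "m * (xm \<bullet> y) = l * (x \<bullet> y) + l' * (x' \<bullet> y)"
      using arg_cong[OF mxm, of "\<lambda>u. u \<bullet> y"] by (simp add: inner_add_left)
    then show ?thesis
      by (simp add: d_def m_def inner_diff_left inner_diff_right inner_commute algebra_simps)
  qed
  have "exp (- (l * ((x - y) \<bullet> (x - y)))) * exp (- (l' * ((x' - y) \<bullet> (x' - y))))
      = exp (- d) * exp (- (m * ((xm - y) \<bullet> (xm - y))))" for y
    unfolding mult_exp_exp using eq[of y] by (intro arg_cong[of _ _ exp]) linarith
  then have eq': "(c * exp (- (l * ((x - y) \<bullet> (x - y))))) * (c' * exp (- (l' * ((x' - y) \<bullet> (x' - y)))))
      = (c * c' * exp (- d)) * exp (- (m * ((xm - y) \<bullet> (xm - y))))" for y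
    by (simp add: mult_ac)
  then show ?thesis
    unfolding eq' using \<open>xm \<in> B\<close> m by (intro gaussian_sum.gaussian) auto
qed

lemma gaussian_sum_mult:
  assumes "convex B" "gaussian_sum B f" "gaussian_sum B g"
  shows "gaussian_sum B (\<lambda>y. f y * g y)"
  using assms(2)
proof induction
  case (gaussian x l c)
  show ?case using assms(3)
  proof induction
    case (gaussian x' l' c')
    then show ?case using gaussian_product[OF assms(1)] \<open>x \<in> B\<close> \<open>0 \<le> l\<close> by blast
  next
    case (add f g)
    then show ?case unfolding distrib_left by (intro gaussian_sum.add)
  qed
next
  case (add f f')
  then show ?case unfolding distrib_right by (intro gaussian_sum.add)
qed

text \<open>
  The points equidistant from \<open>y\<close> and \<open>y'\<close> lie on a hyperplane, which cannot contain an open set.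
  Moving from a point \<open>z\<close> in the direction of \<open>y - y'\<close> leaves it.
\<close>

lemma gaussian_separates_points:
  fixes y y' :: "'a::euclidean_space"
  assumes "open B" "B \<noteq> {}" "y \<noteq> y'"
  shows "\<exists>f. gaussian_sum B f \<and> f y \<noteq> f y'"
proof -
  obtain z e where z: "z \<in> B" "e > 0" "ball z e \<subseteq> B"
    using assms(1,2) by (meson ex_in_conv open_contains_ball)
  define g where "g x = (x - y) \<bullet> (x - y) - (x - y') \<bullet> (x - y')" for x
  define u where "u = y - y'"
  have u: "norm u > 0" using assms(3) by (simp add: u_def)
  define t where "t = e / (2 * norm u)"
  have t: "t > 0" "z + t *\<^sub>R u \<in> B"
    using z u by (auto simp: t_def dist_norm intro!: subsetD[OF z(3)])
  have "g (z + t *\<^sub>R u) = g z - 2 * t * (u \<bullet> u)"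
    by (simp add: g_def u_def inner_add inner_diff inner_commute algebra_simps)
  moreover have "u \<bullet> u > 0" using u by simp
  ultimately have "g z \<noteq> 0 \<or> g (z + t *\<^sub>R u) \<noteq> 0"
    using t by simp
  then obtain x where x: "x \<in> B" "g x \<noteq> 0"
    using z t by blast
  then have "exp (- (1 * ((x - y) \<bullet> (x - y)))) \<noteq> exp (- (1 * ((x - y') \<bullet> (x - y'))))"
    by (simp add: g_def)
  then show ?thesis
    using gaussian_sum.gaussian[OF x(1), of 1 1]
    by (intro exI[of _ "\<lambda>y. 1 * exp (- (1 * ((x - y) \<bullet> (x - y))))"]) simp
qed

text \<open>
  The sign of \<open>w\<close> is an almost everywhere limit of continuous functions. Truncated to \<open>[-1, 1]\<close>
  these are dominated, hence the integral of \<open>\<bar>w\<bar>\<close> is a limit of zeros.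
\<close>

lemma AE_eq_0_if_continuous_integrals_0:
  fixes w :: "'a::euclidean_space \<Rightarrow> real"
  assumes w: "integrable lebesgue w"
    and zero: "\<And>g. continuous_on UNIV g \<Longrightarrow> (LINT y|lebesgue. w y * g y) = 0"
  shows "AE y in lebesgue. w y = 0"
proof -
  have [measurable]: "w \<in> borel_measurable lebesgue"
    using w by auto
  have "(\<lambda>y. sgn (w y)) \<in> borel_measurable lebesgue"
    unfolding sgn_real_def by measurable
  then have "(\<lambda>y. sgn (w y)) measurable_on UNIV"
    by (simp add: lebesgue_measurable_imp_measurable_on_real)
  then obtain N g where N: "negligible N" and g: "\<And>n. continuous_on UNIV (g n)"
    and lim: "\<And>y. y \<notin> N \<Longrightarrow> (\<lambda>n::nat. g n y) \<longlonglongrightarrow> sgn (w y)"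
    unfolding measurable_on_def by auto
  define h where "h n y = max (- 1) (min 1 (g n y))" for n y
  have hc: "continuous_on UNIV (h n)" for n
    unfolding h_def by (intro continuous_intros g)
  have hlim: "(\<lambda>n. h n y) \<longlonglongrightarrow> sgn (w y)" if "y \<notin> N" for y
  proof -
    have "(\<lambda>n. h n y) \<longlonglongrightarrow> max (- 1) (min 1 (sgn (w y)))"
      unfolding h_def by (intro tendsto_intros lim that)
    then show ?thesis by (simp add: sgn_real_def split: if_splits)
  qed
  have "(\<lambda>n. LINT y|lebesgue. w y * h n y) \<longlonglongrightarrow> (LINT y|lebesgue. \<bar>w y\<bar>)"
  proof (rule integral_dominated_convergence[where w = "\<lambda>y. \<bar>w y\<bar>"])
    have "AE y in lebesgue. y \<notin> N"
      using N by (auto simp: eventually_ae_filter_negligible)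
    then show "AE y in lebesgue. (\<lambda>n. w y * h n y) \<longlonglongrightarrow> \<bar>w y\<bar>"
    proof eventually_elim
      case (elim y)
      then show ?case
        using tendsto_mult[OF tendsto_const hlim[OF elim], of "w y"]
        by (simp add: abs_sgn)
    qed
    show "AE y in lebesgue. norm (w y * h n y) \<le> \<bar>w y\<bar>" for n
      by (intro AE_I2) (auto simp: h_def abs_mult intro!: mult_left_le)
    show "(\<lambda>y. w y * h n y) \<in> borel_measurable lebesgue" for n
      using w measurable_completion[of "h n" lborel borel] borel_measurable_continuous_onI[OF hc[of n]]
      by (intro borel_measurable_times) auto
  qed (use w in auto)
  then have "(LINT y|lebesgue. \<bar>w y\<bar>) = 0"
    by (simp add: zero hc LIMSEQ_const_iff)
  then show ?thesis
    using integral_nonneg_eq_0_iff_AE[of lebesgue "\<lambda>y. \<bar>w y\<bar>"] w by simp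
qed

text \<open>
  The condition on \<open>q\<close> keeps all the exponents \<open>q - k\<close> away from that of the fundamental solution of
  the Laplace equation, so that the exponent can be raised indefinitely.
\<close>

lemma riesz_unique_continuation:
  fixes w :: "'a::euclidean_space \<Rightarrow> real"
  assumes w: "integrable lebesgue w" and S: "compact S" "\<And>y. y \<notin> S \<Longrightarrow> w y = 0"
    and U: "open U" "U \<noteq> {}" "\<And>y. y \<in> U \<Longrightarrow> w y = 0"
    and q: "q < 0" "\<And>k::nat. real DIM('a) + 2 * (q - real k) \<noteq> 2"
    and zero: "\<And>x. x \<in> U \<Longrightarrow> conv w (\<lambda>z. (z \<bullet> z) powr q) x = 0"
  shows "AE y in lebesgue. w y = 0"
proof -
  have all: "\<forall>x\<in>U. conv w (\<lambda>z. (z \<bullet> z) powr (q - real k)) x = 0" for k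
  proof (induction k)
    case (Suc k)
    show ?case
      using riesz_raise_exponent[OF w U(1,3), of "q - real k"] q(1) q(2)[of k] Suc
      by (auto simp: algebra_simps)
  qed (use zero in simp)
  obtain z e where z: "e > 0" "ball z e \<subseteq> U"
    using U(1,2) by (meson ex_in_conv open_contains_ball)
  define B where "B = ball z e"
  have B: "B \<subseteq> U" "convex B" "open B" "B \<noteq> {}" "z \<in> B"
    using z by (auto simp: B_def)
  have int: "integrable lebesgue (\<lambda>y. w y * g y)" if "continuous_on UNIV g" for g
    using integrable_times_continuous[OF w S that] .
  have gauss: "(LINT y|lebesgue. w y * f y) = 0" if "gaussian_sum B f" for f
    using that
  proof induction
    case (gaussian x l c)
    have x: "x \<in> U" using gaussian B by blast
    have "continuous_on UNIV (\<lambda>t::real. exp (- (l * t)))"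
      by (intro continuous_intros)
    from radial_integral_eq_0[OF w S U(1) x U(3) q(1) _ this] all x
    have "(LINT y|lebesgue. w y * exp (- (l * ((x - y) \<bullet> (x - y))))) = 0"
      by blast
    then show ?case
      by (simp add: mult.left_commute[of _ c])
  next
    case (add f g)
    then show ?case
      unfolding distrib_left
      by (subst Bochner_Integration.integral_add) (auto intro!: int gaussian_sum_continuous)
  qed
  have "(LINT y|lebesgue. w y * g y) = 0" if g: "continuous_on UNIV g" for g
  proof (rule integral_eq_0_by_approximation[where H = "\<lambda>y. 1"])
    fix \<epsilon> :: real assume "\<epsilon> > 0"
    then have "\<exists>h. gaussian_sum B h \<and> (\<forall>y\<in>S. \<bar>g y - h y\<bar> < \<epsilon>)"
    proof (intro Stone_Weierstrass_HOL)
      show "gaussian_sum B (\<lambda>x. c)" for c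
        using gaussian_sum.gaussian[OF B(5), of 0 c] by simp
      show "\<exists>f. gaussian_sum B f \<and> f y \<noteq> f y'" if "y \<in> S \<and> y' \<in> S \<and> y \<noteq> y'" for y y'
        using gaussian_separates_points[OF B(3,4)] that by blast
    qed (use S g gaussian_sum_continuous gaussian_sum_mult[OF B(2)] gaussian_sum.add
         continuous_on_subset in \<open>blast+\<close>)
    then obtain h where h: "gaussian_sum B h" "\<And>y. y \<in> S \<Longrightarrow> \<bar>g y - h y\<bar> < \<epsilon>"
      by blast
    then show "\<exists>h. integrable lebesgue (\<lambda>y. w y * h y) \<and> (LINT y|lebesgue. w y * h y) = 0 \<and>
        (\<forall>y. w y \<noteq> 0 \<longrightarrow> \<bar>g y - h y\<bar> \<le> \<epsilon> * 1)"
      using S(2) by (intro exI[of _ h]) (auto intro!: int gaussian_sum_continuous gauss less_imp_le)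
  qed (use w int[OF g] in auto)
  then show ?thesis
    by (rule AE_eq_0_if_continuous_integrals_0[OF w])
qed

section \<open>From the regional fractional Laplacian to a Riesz potential\<close>

lemma sigma_finite_lebesgue: "sigma_finite_measure (lebesgue :: 'a::euclidean_space measure)"
proof
  obtain A :: "'a set set" where A: "countable A" "A \<subseteq> sets lborel" "\<Union>A = space lborel"
    "\<forall>a\<in>A. emeasure lborel a \<noteq> \<infinity>"
    using lborel.sigma_finite_countable by blast
  then have "emeasure lebesgue a = emeasure lborel a" if "a \<in> A" for a
    using that by (subst emeasure_completion) auto
  with A show "\<exists>A::'a set set. countable A \<and> A \<subseteq> sets lebesgue \<and> \<Union>A = space lebesgue \<and>
      (\<forall>a\<in>A. emeasure lebesgue a \<noteq> \<infinity>)"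
    by (intro exI[of _ A]) auto
qed

interpretation lebesgue_pair: pair_sigma_finite
  "lebesgue :: 'a::euclidean_space measure" "lebesgue :: 'b::euclidean_space measure"
  by (simp add: pair_sigma_finite_def sigma_finite_lebesgue)

text \<open>
  Completeness of the measure makes measurability of \<open>f\<close> automatic. This matters for the regional
  pairing, whose iterated integrals involve a function that is only known almost everywhere.
\<close>

lemma integral_cong_AE_lebesgue:
  fixes f g :: "'a::euclidean_space \<Rightarrow> real"
  assumes g: "g \<in> borel_measurable lebesgue" and eq: "AE x in lebesgue. f x = g x"
  shows "integral\<^sup>L lebesgue f = integral\<^sup>L lebesgue g"
proof (rule integral_cong_AE)
  show "f \<in> borel_measurable lebesgue"
    by (rule borel_measurable_AE[OF g]) (use eq in \<open>auto elim: eventually_mono\<close>)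
qed (use assms in auto)

text \<open>
  With \<open>\<psi>\<close> a bump inside \<open>U\<close> and \<open>w \<psi> = 0\<close>, the numerator \<open>(w(x) - w(y)) (\<psi>(x) - \<psi>(y))\<close> becomes
  \<open>- \<psi>(x) w(y) - \<psi>(y) w(x)\<close>. Both terms are integrable over the product space because \<open>\<psi>\<close> and
  \<open>w\<close> have supports at positive distance, and by Fubini's theorem and the symmetry of the kernel
  they have the same integral. The positive distance is used only through the bound \<open>M\<close>.
\<close>

lemma regional_vanishing_imp_weakly_0:
  fixes w v :: "'a::euclidean_space \<Rightarrow> real" and \<Omega> U :: "'a set" and a C :: real
  defines "\<kappa> \<equiv> \<lambda>z::'a. (z \<bullet> z) powr (- (real DIM('a) + 2 * a) / 2)"
  assumes a: "0 \<le> real DIM('a) + 2 * a" and C: "C \<noteq> 0"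
    and w: "integrable lebesgue w" "\<And>y. y \<in> U \<Longrightarrow> w y = 0" "\<And>y. y \<notin> \<Omega> \<Longrightarrow> w y = 0"
    and vw: "AE x in lebesgue. x \<in> \<Omega> \<longrightarrow> v x = w x"
    and U: "U \<subseteq> \<Omega>"
    and vanish: "regional_laplacian_vanishes_on C a \<Omega> v U"
    and r: "r > 0" "cball z r \<subseteq> U"
    and M: "\<And>x y. x \<in> ball z r \<Longrightarrow> \<bar>w y * \<kappa> (x - y)\<bar> \<le> M * \<bar>w y\<bar>"
  shows "integrable lebesgue (\<lambda>x. bump z r x * conv w \<kappa> x)"
    and "(LINT x|lebesgue. bump z r x * conv w \<kappa> x) = 0"
proof -
  define \<psi> where "\<psi> = bump z r"
  define F where "F x y = \<psi> x * (w y * \<kappa> (x - y))" for x y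
  have \<psi>0: "\<psi> x = 0" if "x \<notin> U" for x
  proof -
    have "x \<notin> ball z r" using that r(2) ball_subset_cball by blast
    then show ?thesis using r(1) by (simp add: \<psi>_def bump_eq_0_iff)
  qed
  have \<psi>w: "\<psi> x * w x = 0" for x
    using \<psi>0[of x] w(2)[of x] by (cases "x \<in> U") auto
  have [measurable]: "w \<in> borel_measurable lebesgue" "\<psi> \<in> borel_measurable lebesgue"
    using w(1) bump_integrable[OF r(1)] by (auto simp: \<psi>_def)
  have [measurable]: "(\<lambda>x::'a. x) \<in> lebesgue \<rightarrow>\<^sub>M borel"
    by (rule measurable_completion) simp
  have [measurable]: "\<kappa> \<in> borel_measurable borel"
    unfolding \<kappa>_def by measurable
  have "integrable (lebesgue \<Otimes>\<^sub>M lebesgue) (\<lambda>p. \<psi> (fst p) * (M * \<bar>w (snd p)\<bar>))"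
  proof (rule lebesgue_pair.Fubini_integrable)
    show "integrable lebesgue (\<lambda>x. LINT y|lebesgue. norm (\<psi> (fst (x, y)) * (M * \<bar>w (snd (x, y))\<bar>)))"
      using bump_integrable[OF r(1), of z] by (simp add: abs_mult \<psi>_def)
  qed (use w in auto)
  then have int: "integrable (lebesgue \<Otimes>\<^sub>M lebesgue) (case_prod F)"
  proof (rule Bochner_Integration.integrable_bound)
    have [measurable]: "(\<lambda>p. fst p - snd p :: 'a) \<in> borel_measurable (lebesgue \<Otimes>\<^sub>M lebesgue)"
      by (intro borel_measurable_diff measurable_compose[OF measurable_fst]
            measurable_compose[OF measurable_snd]) auto
    show "case_prod F \<in> borel_measurable (lebesgue \<Otimes>\<^sub>M lebesgue)"
      unfolding F_def case_prod_beta by measurable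
    show "AE p in lebesgue \<Otimes>\<^sub>M lebesgue. norm (case_prod F p) \<le> norm (\<psi> (fst p) * (M * \<bar>w (snd p)\<bar>))"
    proof (intro AE_I2)
      fix p :: "'a \<times> 'a"
      obtain x y where p: "p = (x, y)" by (cases p)
      show "norm (case_prod F p) \<le> norm (\<psi> (fst p) * (M * \<bar>w (snd p)\<bar>))"
      proof (cases "x \<in> ball z r")
        case True
        have "\<bar>\<psi> x\<bar> * \<bar>w y * \<kappa> (x - y)\<bar> \<le> \<bar>\<psi> x\<bar> * \<bar>M * \<bar>w y\<bar>\<bar>"
          using M[OF True, of y] by (intro mult_left_mono) auto
        then show ?thesis by (simp add: p F_def abs_mult)
      next
        case False
        then have "\<psi> x = 0" using r by (simp add: \<psi>_def bump_eq_0_iff)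
        then show ?thesis by (simp add: p F_def)
      qed
    qed
  qed
  define A B where "A x = (LINT y|lebesgue. F x y)" and "B x = (LINT y|lebesgue. F y x)" for x
  have A: "integrable lebesgue A"
    unfolding A_def by (rule lebesgue_pair.integrable_fst[OF int])
  have B: "integrable lebesgue B"
    unfolding B_def by (rule lebesgue_pair.integrable_snd[OF int])
  have AB: "integral\<^sup>L lebesgue B = integral\<^sup>L lebesgue A"
    unfolding A_def B_def
    by (simp add: lebesgue_pair.integral_fst[OF int] lebesgue_pair.integral_snd[OF int])
  have A_eq: "A x = bump z r x * conv w \<kappa> x" for x
    by (simp add: A_def F_def conv_def \<psi>_def)
  have \<kappa>_sym: "\<kappa> (y - x) = \<kappa> (x - y)" for x y
    by (simp add: \<kappa>_def inner_diff algebra_simps inner_commute)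
  have \<kappa>_norm: "t / norm (x - y) powr (real DIM('a) + 2 * a) = t * \<kappa> (x - y)" for t and x y :: 'a
    by (simp add: \<kappa>_def inner_self_powr divide_powr_uminus diff_divide_distrib)
  let ?f = "\<lambda>x y. (v x - v y) * (\<psi> x - \<psi> y) / norm (x - y) powr (real DIM('a) + 2 * a)"
  \<comment> \<open>the inner integral of the pairing, for almost every x; outside of Omega both sides are zero\<close>
  have "AE x in lebesgue. indicator \<Omega> x *\<^sub>R (LINT y:\<Omega>|lebesgue. ?f x y) = - A x - B x"
    using vw lebesgue_pair.AE_integrable_fst[OF int] lebesgue_pair.AE_integrable_snd[OF int]
  proof eventually_elim
    case (elim x)
    show ?case
    proof (cases "x \<in> \<Omega>")
      case True
      have "(LINT y:\<Omega>|lebesgue. ?f x y) = (LINT y|lebesgue. - F x y - F y x)"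
        unfolding set_lebesgue_integral_def
      proof (rule integral_cong_AE_lebesgue)
        show "(\<lambda>y. - F x y - F y x) \<in> borel_measurable lebesgue"
          using elim by (intro borel_measurable_diff borel_measurable_uminus) auto
        show "AE y in lebesgue. indicator \<Omega> y *\<^sub>R ?f x y = - F x y - F y x"
          using vw
        proof eventually_elim
          case (elim y)
          show ?case
          proof (cases "y \<in> \<Omega>")
            case y: True
            have "?f x y = (w x - w y) * (\<psi> x - \<psi> y) * \<kappa> (x - y)"
              using elim y \<open>x \<in> \<Omega> \<longrightarrow> v x = w x\<close> True by (simp add: \<kappa>_norm)
            also have "\<dots> = (\<psi> x * w x + \<psi> y * w y - \<psi> x * w y - \<psi> y * w x) * \<kappa> (x - y)"
              by (simp add: algebra_simps)
            also have "\<dots> = - F x y - F y x"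
              by (simp add: \<psi>w F_def \<kappa>_sym[of y x] algebra_simps)
            finally show ?thesis using y by simp
          next
            case False
            then show ?thesis using w(3) \<psi>0 U by (auto simp: F_def)
          qed
        qed
      qed
      also have "\<dots> = - A x - B x"
        using elim by (simp add: A_def B_def)
      finally show ?thesis using True by simp
    next
      case False
      then have "w x = 0" "\<psi> x = 0" using w(3) \<psi>0 U by auto
      then show ?thesis using False by (simp add: A_def B_def F_def)
    qed
  qed
  then have "(LINT x:\<Omega>|lebesgue. (LINT y:\<Omega>|lebesgue. ?f x y)) = (LINT x|lebesgue. - A x - B x)"
    unfolding set_lebesgue_integral_def[of lebesgue \<Omega> "\<lambda>x. LINT y:\<Omega>|lebesgue. ?f x y"]
    using A B by (intro integral_cong_AE_lebesgue) auto
  also have "\<dots> = - 2 * integral\<^sup>L lebesgue A"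
    using A B AB by simp
  finally have "regional_pairing C a \<Omega> v \<psi> = - C * integral\<^sup>L lebesgue A"
    by (simp add: regional_pairing_def)
  moreover have "regional_pairing C a \<Omega> v \<psi> = 0"
    using vanish bump_in_test_functions[OF r] by (simp add: regional_laplacian_vanishes_on_def \<psi>_def)
  ultimately have "integral\<^sup>L lebesgue A = 0" using C by simp
  then show "(LINT x|lebesgue. bump z r x * conv w \<kappa> x) = 0"
    and "integrable lebesgue (\<lambda>x. bump z r x * conv w \<kappa> x)"
    using A by (simp_all add: A_eq[abs_def])
qed

lemma bump_integrals_0_imp_nonpos:
  fixes G :: "'a::euclidean_space \<Rightarrow> real"
  assumes cont: "isCont G z" and R: "R > 0"
    and int: "\<And>r. 0 < r \<Longrightarrow> r < R \<Longrightarrow> integrable lebesgue (\<lambda>x. bump z r x * G x)"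
    and zero: "\<And>r. 0 < r \<Longrightarrow> r < R \<Longrightarrow> (LINT x|lebesgue. bump z r x * G x) = 0"
  shows "G z \<le> 0"
proof (rule ccontr)
  assume "\<not> G z \<le> 0"
  then have "G z > 0" by simp
  then obtain e where e: "e > 0" "\<And>x. dist x z < e \<Longrightarrow> dist (G x) (G z) < G z"
    using cont unfolding continuous_at_eps_delta by blast
  define r where "r = min e (R / 2)"
  have r: "0 < r" "r < R" "r \<le> e" using e R by (auto simp: r_def)
  have pos: "G x > 0" if "x \<in> ball z r" for x
    using e(2)[of x] that r(3) by (simp add: dist_commute dist_real_def)
  have nonneg: "bump z r x * G x \<ge> 0" for x
    using pos[of x] bump_nonneg[of z r x] bump_eq_0_iff[OF r(1), of z x]
    by (cases "x \<in> ball z r") auto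
  have "AE x in lebesgue. bump z r x * G x = 0"
    using integral_nonneg_eq_0_iff_AE[OF int[OF r(1,2)]] zero[OF r(1,2)] nonneg by simp
  then have "AE x \<in> ball z r in lebesgue. x \<in> {}"
    by eventually_elim (use pos bump_eq_0_iff[OF r(1), of z] in fastforce)
  then have "z \<in> {}"
    by (rule mem_closed_if_AE_lebesgue_open[rotated 2]) (use r in auto)
  then show False by simp
qed

text \<open>
  The potential is continuous on \<open>U\<close> and orthogonal to all small bumps around \<open>z\<close>; applying the
  preceding lemma to it and to its negative shows that it vanishes at \<open>z\<close>.
\<close>

lemma regional_vanishing_imp_riesz_0:
  fixes w v :: "'a::euclidean_space \<Rightarrow> real" and \<Omega> U :: "'a set"
  assumes a: "0 \<le> real DIM('a) + 2 * a" and C: "C \<noteq> 0"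
    and w: "integrable lebesgue w" "\<And>y. y \<in> U \<Longrightarrow> w y = 0" "\<And>y. y \<notin> \<Omega> \<Longrightarrow> w y = 0"
    and vw: "AE x in lebesgue. x \<in> \<Omega> \<longrightarrow> v x = w x"
    and U: "open U" "U \<subseteq> \<Omega>" "z \<in> U"
    and vanish: "regional_laplacian_vanishes_on C a \<Omega> v U"
  shows "conv w (\<lambda>z. (z \<bullet> z) powr (- (real DIM('a) + 2 * a) / 2)) z = 0"
proof -
  let ?K = "\<lambda>z::'a. (z \<bullet> z) powr (- (real DIM('a) + 2 * a) / 2)"
  have K: "tame_kernel ?K" using a by (intro tame_riesz) simp
  obtain R M where R: "R > 0" "ball z (2 * R) \<subseteq> U"
    and M: "\<And>x y. x \<in> ball z R \<Longrightarrow> \<bar>w y * ?K (x - y)\<bar> \<le> M * \<bar>w y\<bar>"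
    using tame_kernel_uniform_bound[where w = w, OF K U(1,3) w(2)] by blast
  have cont: "isCont (conv w ?K) z"
    by (intro conv_isCont[OF K w(1) U(1,3) w(2)] continuous_intros) auto
  have weak: "integrable lebesgue (\<lambda>x. bump z r x * conv w ?K x) \<and>
      (LINT x|lebesgue. bump z r x * conv w ?K x) = 0" if r: "0 < r" "r < R" for r
  proof -
    have "cball z r \<subseteq> U" using r R by auto
    moreover have "\<bar>w y * ?K (x - y)\<bar> \<le> M * \<bar>w y\<bar>" if "x \<in> ball z r" for x y
      using that r by (intro M) auto
    ultimately show ?thesis
      using regional_vanishing_imp_weakly_0[OF a C w vw U(2) vanish r(1), of z M] by blast
  qed
  have "conv w ?K z \<le> 0"
    using weak by (intro bump_integrals_0_imp_nonpos[OF cont R(1)]) auto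
  moreover have "- conv w ?K z \<le> 0"
    using weak cont
    by (intro bump_integrals_0_imp_nonpos[where G = "\<lambda>x. - conv w ?K x", OF _ R(1)]) auto
  ultimately show ?thesis by simp
qed

theorem lemma3p4:
  fixes \<Omega> U :: "(real ^ 'n) set" and v :: "real ^ 'n \<Rightarrow> real" and a C :: real
  assumes "bounded_lipschitz_domain \<Omega>"
    and "0 < a" and "a < 1" and "C > 0"
    and "v \<in> sobolev_on a \<Omega>"
    and "open U" and "U \<noteq> {}" and "compact (closure U)" and "closure U \<subseteq> \<Omega>"
    and "AE x\<in>U in lebesgue. v x = 0"
    and "regional_laplacian_vanishes_on C a \<Omega> v U"
  shows "AE x\<in>\<Omega> in lebesgue. v x = 0"
proof -
  obtain w0 where w0: "square_integrable w0" "AE x\<in>\<Omega> in lebesgue. v x = w0 x"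
    using assms(5) by (auto simp: sobolev_on_def sobolev_def)
  have \<Omega>: "open \<Omega>" "bounded \<Omega>"
    using assms(1) by (auto simp: bounded_lipschitz_domain_def)
  have U\<Omega>: "U \<subseteq> \<Omega>" using assms(9) closure_subset by blast
  \<comment> \<open>w vanishes on U and outside Omega at every point, not only almost everywhere\<close>
  define w where "w x = indicator (\<Omega> - U) x * w0 x" for x
  have [measurable]: "\<Omega> \<in> sets lebesgue" "U \<in> sets lebesgue" "w0 \<in> borel_measurable lebesgue"
    using \<Omega> assms(6) w0(1) by (auto simp: square_integrable_def)
  have wm: "w \<in> borel_measurable lebesgue"
    unfolding w_def by measurable
  have w: "integrable lebesgue w"
  proof (rule Bochner_Integration.integrable_bound[OF _ wm])
    have "emeasure lebesgue \<Omega> < \<infinity>"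
      using \<Omega> emeasure_bounded_finite[of \<Omega>] by simp
    then show "integrable lebesgue (\<lambda>x. indicat_real \<Omega> x + (w0 x)\<^sup>2)"
      using w0(1) by (intro Bochner_Integration.integrable_add integrable_real_indicator)
        (auto simp: square_integrable_def)
    \<comment> \<open>on a bounded set, square integrable functions are integrable\<close>
    have "\<bar>t\<bar> \<le> 1 + t\<^sup>2" for t :: real
      using zero_le_power2[of "\<bar>t\<bar> - 1"] by (simp add: power2_eq_square algebra_simps) 
    then show "AE x in lebesgue. norm (w x) \<le> norm (indicat_real \<Omega> x + (w0 x)\<^sup>2)"
      by (intro AE_I2) (auto simp: w_def indicator_def)
  qed
  have w_0: "w y = 0" if "y \<in> U" for y using that by (simp add: w_def)
  have w_0': "w y = 0" if "y \<notin> \<Omega>" for y using that by (simp add: w_def)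
  have vw: "AE x in lebesgue. x \<in> \<Omega> \<longrightarrow> v x = w x"
    using w0(2) assms(10) by eventually_elim (auto simp: w_def)
  let ?q = "- (real DIM(real ^ 'n) + 2 * a) / 2"
  have "AE y in lebesgue. w y = 0"
  proof (rule riesz_unique_continuation[OF w _ _ assms(6,7) w_0])
    show "compact (closure \<Omega>)" using \<Omega>(2) by simp
    show "w y = 0" if "y \<notin> closure \<Omega>" for y
      using that closure_subset w_0' by blast
    show "?q < 0" using assms(2) by (simp add: add_nonneg_pos)
    show "real DIM(real ^ 'n) + 2 * (?q - real k) \<noteq> 2" for k
      using assms(2) by (simp add: field_simps)
    show "conv w (\<lambda>z. (z \<bullet> z) powr ?q) x = 0" if "x \<in> U" for x
      using assms(2,4) that
      by (intro regional_vanishing_imp_riesz_0[OF _ _ w w_0 w_0' vw assms(6) U\<Omega> that assms(11)]) auto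
  qed
  with vw show ?thesis by eventually_elim simp
qed

end
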